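(* Let $A,B$ be closed subsets of a finite-dimensional Hilbert space $\mathcal{H}$ with $A\cap B\neq\emptyset$. If $\mathbf{x}\in\operatorname{Fix}C_T$, then $\mathbb{P}_A\mathbf{x}\cap A\cap B\neq\emptyset$.
   Context: For closed nonempty $S\subset\mathcal{H}$, $\mathbb{P}_S\mathbf{x}=\{\mathbf{z}\in S:\|\mathbf{x}-\mathbf{z}\|=\inf_{\mathbf{v}\in S}\|\mathbf{x}-\mathbf{v}\|\}$ and $P_S$ is a fixed selector, $P_S\mathbf{x}\in\mathbb{P}_S\mathbf{x}$; $R_S=2P_S-\mathrm{Id}$; $T_{A,B}=\frac12R_BR_A+\frac12\mathrm{Id}$. The circumcenter $C(\mathbf{u},\mathbf{v},\mathbf{w})$ is the point of the affine hull of $\{\mathbf{u},\mathbf{v},\mathbf{w}\}$ equidistant from $\mathbf{u},\mathbf{v},\mathbf{w}$, and $\mathrm{CRM}(\mathbf{x})=C(\mathbf{x},R_A\mathbf{x},R_BR_A\mathbf{x})$. Three points are colinear if they lie on a common line (in particular if two of them coincide). $C_T:\mathcal{H}\to\mathcal{H}$ is defined by $C_T\mathbf{x}=T_{A,B}\mathbf{x}$ if $\mathbf{x},R_A\mathbf{x},R_BR_A\mathbf{x}$ are colinear, and $C_T\mathbf{x}=\mathrm{CRM}(\mathbf{x})$ otherwise. $\operatorname{Fix}C_T=\{\mathbf{x}:C_T\mathbf{x}=\mathbf{x}\}$. *)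

theory Defs
  imports "HOL-Analysis.Analysis"
begin

text \<open>
  A finite-dimensional Hilbert space is a type of class \<open>real_inner\<close> with a finite spanning
  set (completeness is then automatic). Unlike class \<open>euclidean_space\<close>, this also admits
  dimension 0.
\<close>

definition finite_dim :: "'a::real_vector itself \<Rightarrow> bool" where
  "finite_dim _ \<longleftrightarrow> (\<exists>E :: 'a set. finite E \<and> span E = UNIV)"

definition proj_set :: "'a::real_inner set \<Rightarrow> 'a \<Rightarrow> 'a set" where
  "proj_set S x = {z \<in> S. norm (x - z) = (INF v\<in>S. norm (x - v))}"

text \<open>
  In the following, \<open>P\<close> is a selector of the set-valued projections, indexed by the
  set projected onto: \<open>P S x\<close> is a chosen element of \<open>proj_set S x\<close> for closed
  nonempty \<open>S\<close>.
\<close>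

definition proj_selector :: "('a::real_inner set \<Rightarrow> 'a \<Rightarrow> 'a) \<Rightarrow> bool" where
  "proj_selector P \<longleftrightarrow> (\<forall>S x. closed S \<longrightarrow> S \<noteq> {} \<longrightarrow> P S x \<in> proj_set S x)"

definition reflection :: "('a::real_inner set \<Rightarrow> 'a \<Rightarrow> 'a) \<Rightarrow> 'a set \<Rightarrow> 'a \<Rightarrow> 'a" where
  "reflection P S x = 2 *\<^sub>R P S x - x"

definition DR :: "('a::real_inner set \<Rightarrow> 'a \<Rightarrow> 'a) \<Rightarrow> 'a set \<Rightarrow> 'a set \<Rightarrow> 'a \<Rightarrow> 'a" where
  "DR P A B x = (1/2) *\<^sub>R reflection P B (reflection P A x) + (1/2) *\<^sub>R x"

text \<open>
  A point as described exists and is unique whenever the three points are not collinear,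
  the only case in which \<open>C_T\<close> uses it.
\<close>

definition circumcenter :: "'a::real_inner \<Rightarrow> 'a \<Rightarrow> 'a \<Rightarrow> 'a" where
  "circumcenter u v w =
    (THE p. p \<in> affine hull {u, v, w} \<and> dist p u = dist p v \<and> dist p v = dist p w)"

definition CRM :: "('a::real_inner set \<Rightarrow> 'a \<Rightarrow> 'a) \<Rightarrow> 'a set \<Rightarrow> 'a set \<Rightarrow> 'a \<Rightarrow> 'a" where
  "CRM P A B x =
    circumcenter x (reflection P A x) (reflection P B (reflection P A x))"

definition C_T :: "('a::real_inner set \<Rightarrow> 'a \<Rightarrow> 'a) \<Rightarrow> 'a set \<Rightarrow> 'a set \<Rightarrow> 'a \<Rightarrow> 'a" where
  "C_T P A B x =
    (if collinear {x, reflection P A x, reflection P B (reflection P A x)}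
     then DR P A B x else CRM P A B x)"

definition Fix :: "('a \<Rightarrow> 'a) \<Rightarrow> 'a set" where
  "Fix f = {x. f x = x}"

end

theory Submission
  imports Defs
begin

text \<open>
  A fixed point of \<open>C_T\<close> can only arise from the Douglas--Rachford branch. For non-collinear
  \<open>x\<close>, \<open>R\<^sub>A x\<close>, \<open>R\<^sub>B R\<^sub>A x\<close> the circumcenter is equidistant from its three vertices; if it were the
  vertex \<open>x\<close>, all distances would vanish and the three points would coincide, so they would be
  collinear after all. The only substantial point is that the circumcenter of a non-collinear
  triple really exists and is unique, so that the definite description has its defining property:
  lemma \<open>circumcenter_equidistant\<close>.

  In the Douglas--Rachford branch, \<open>x = (R\<^sub>B R\<^sub>A x + x) / 2\<close> says \<open>R\<^sub>B R\<^sub>A x = x\<close>. Hence the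
  projection of \<open>R\<^sub>A x\<close> onto \<open>B\<close> is the midpoint of \<open>R\<^sub>A x\<close> and \<open>x\<close>, which is \<open>P\<^sub>A x\<close>. So the
  selected projection of \<open>x\<close> onto \<open>A\<close> lies in \<open>B\<close>.
\<close>

text \<open>
  The quadratic terms in \<open>p\<close> cancel when the two squared distances are compared, which turns the circumcenter
  conditions into linear equations.
\<close>

lemma dist_eq_iff_inner_half:
  fixes p u v :: "'a::real_inner"
  shows "dist p u = dist p v \<longleftrightarrow> (p - u) \<bullet> (v - u) = (v - u) \<bullet> (v - u) / 2"
proof -
  have "dist p u = dist p v \<longleftrightarrow> (p - u) \<bullet> (p - u) = (p - v) \<bullet> (p - v)"
    by (simp add: dist_norm norm_eq)
  also have "\<dots> \<longleftrightarrow> (p - u) \<bullet> (v - u) = (v - u) \<bullet> (v - u) / 2"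
    by (simp add: inner_diff_left inner_diff_right inner_commute) (auto simp: field_simps)
  finally show ?thesis .
qed

lemma gram_det_nonzero:
  fixes u v w :: "'a::real_inner"
  assumes "\<not> collinear {u, v, w}"
  shows "((v - u) \<bullet> (v - u)) * ((w - u) \<bullet> (w - u)) - ((v - u) \<bullet> (w - u))\<^sup>2 \<noteq> 0"
proof
  assume "((v - u) \<bullet> (v - u)) * ((w - u) \<bullet> (w - u)) - ((v - u) \<bullet> (w - u))\<^sup>2 = 0"
  then have "\<bar>(v - u) \<bullet> (w - u)\<bar>\<^sup>2 = (norm (v - u) * norm (w - u))\<^sup>2"
    by (simp add: power_mult_distrib dot_square_norm)
  then have "\<bar>(v - u) \<bullet> (w - u)\<bar> = norm (v - u) * norm (w - u)"
    by (rule power2_eq_imp_eq) auto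
  then have "collinear {0, v - u, w - u}"
    by (simp add: norm_cauchy_schwarz_equal)
  then have "collinear {v, u, w}"
    by (subst collinear_3) auto
  with assms show False
    by (simp add: insert_commute)
qed

lemma affine_hull_3_translate:
  fixes u v w :: "'a::real_vector"
  shows "p \<in> affine hull {u, v, w} \<longleftrightarrow>
    (\<exists>s t. p = u + s *\<^sub>R (v - u) + t *\<^sub>R (w - u))"
proof -
  have "p \<in> affine hull {u, v, w} \<longleftrightarrow>
      (\<exists>r s t. p = r *\<^sub>R u + s *\<^sub>R v + t *\<^sub>R w \<and> r = 1 - s - t)"
    unfolding affine_hull_3 by (auto simp: algebra_simps)
  also have "\<dots> \<longleftrightarrow> (\<exists>s t. p = u + s *\<^sub>R (v - u) + t *\<^sub>R (w - u))"
  proof -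
    have "r *\<^sub>R u + s *\<^sub>R v + t *\<^sub>R w = u + s *\<^sub>R (v - u) + t *\<^sub>R (w - u)"
      if "r = 1 - s - t" for r s t
      unfolding that by (simp add: algebra_simps)
    then show ?thesis
      by auto
  qed
  finally show ?thesis .
qed

text \<open>
  Writing \<open>p = u + s a + t b\<close> with \<open>a = v - u\<close> and \<open>b = w - u\<close>, equidistance becomes a linear
  system in \<open>s\<close>, \<open>t\<close> with the Gram matrix of \<open>a\<close>, \<open>b\<close>, which Cramer's rule solves. Two solutions
  differ by a vector in the span of \<open>a\<close>, \<open>b\<close> that is orthogonal to both, hence by zero.
\<close>

lemma ex1_circumcenter:
  fixes u v w :: "'a::real_inner"
  assumes "\<not> collinear {u, v, w}"
  shows "\<exists>!p. p \<in> affine hull {u, v, w} \<and> dist p u = dist p v \<and> dist p v = dist p w"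
proof -
  define a where "a = v - u"
  define b where "b = w - u"
  define D where "D = (a \<bullet> a) * (b \<bullet> b) - (a \<bullet> b)\<^sup>2"
  have D: "D \<noteq> 0"
    using gram_det_nonzero[OF assms] by (simp add: D_def a_def b_def)
  have char: "p \<in> affine hull {u, v, w} \<and> dist p u = dist p v \<and> dist p v = dist p w \<longleftrightarrow>
      (\<exists>s t. p = u + s *\<^sub>R a + t *\<^sub>R b) \<and>
      (p - u) \<bullet> a = a \<bullet> a / 2 \<and> (p - u) \<bullet> b = b \<bullet> b / 2" for p
    using dist_eq_iff_inner_half[of p u v] dist_eq_iff_inner_half[of p u w]
    by (auto simp: affine_hull_3_translate a_def b_def)
  show ?thesis
    unfolding char
  proof (rule ex_ex1I)
    define s where "s = (b \<bullet> b) * (a \<bullet> a - a \<bullet> b) / (2 * D)"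
    define t where "t = (a \<bullet> a) * (b \<bullet> b - a \<bullet> b) / (2 * D)"
    have "s * (a \<bullet> a) + t * (a \<bullet> b) = (a \<bullet> a) * D / (2 * D)"
      by (simp add: s_def t_def D_def add_divide_distrib[symmetric])
        (simp add: algebra_simps power2_eq_square)
    moreover have "s * (a \<bullet> b) + t * (b \<bullet> b) = (b \<bullet> b) * D / (2 * D)"
      by (simp add: s_def t_def D_def add_divide_distrib[symmetric])
        (simp add: algebra_simps power2_eq_square)
    ultimately show "\<exists>p. (\<exists>s t. p = u + s *\<^sub>R a + t *\<^sub>R b) \<and>
        (p - u) \<bullet> a = a \<bullet> a / 2 \<and> (p - u) \<bullet> b = b \<bullet> b / 2"
      using D
      by (intro exI[of _ "u + s *\<^sub>R a + t *\<^sub>R b"])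
        (auto simp: add.assoc inner_add_left inner_commute[of b a])
  next
    fix p q
    assume p: "(\<exists>s t. p = u + s *\<^sub>R a + t *\<^sub>R b) \<and>
        (p - u) \<bullet> a = a \<bullet> a / 2 \<and> (p - u) \<bullet> b = b \<bullet> b / 2"
      and q: "(\<exists>s t. q = u + s *\<^sub>R a + t *\<^sub>R b) \<and>
        (q - u) \<bullet> a = a \<bullet> a / 2 \<and> (q - u) \<bullet> b = b \<bullet> b / 2"
    obtain s t s' t' where "p = u + s *\<^sub>R a + t *\<^sub>R b" "q = u + s' *\<^sub>R a + t' *\<^sub>R b"
      using p q by blast
    then have pq: "p - q = (s - s') *\<^sub>R a + (t - t') *\<^sub>R b"
      by (simp add: algebra_simps)
    have "(p - q) \<bullet> a = 0" "(p - q) \<bullet> b = 0"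
      using p q by (auto simp: inner_diff_left)
    then have "(p - q) \<bullet> ((s - s') *\<^sub>R a + (t - t') *\<^sub>R b) = 0"
      by (simp add: inner_add_right)
    then have "(p - q) \<bullet> (p - q) = 0"
      by (simp add: pq[symmetric])
    then show "p = q"
      by simp
  qed
qed

lemma circumcenter_equidistant:
  fixes u v w :: "'a::real_inner"
  assumes "\<not> collinear {u, v, w}"
  shows "dist (circumcenter u v w) u = dist (circumcenter u v w) v"
    and "dist (circumcenter u v w) v = dist (circumcenter u v w) w"
  using theI'[OF ex1_circumcenter[OF assms]] by (simp_all add: circumcenter_def)

lemma circumcenter_neq_vertex:
  fixes u v w :: "'a::real_inner"
  assumes "\<not> collinear {u, v, w}"
  shows "circumcenter u v w \<noteq> u"
  using circumcenter_equidistant(1)[OF assms] assms by auto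

lemma DR_fixed_imp_same_projection:
  assumes "DR P A B x = x"
  shows "P B (reflection P A x) = P A x"
proof -
  have "2 *\<^sub>R DR P A B x = 2 *\<^sub>R x"
    using assms by simp
  then have "reflection P B (reflection P A x) + x = 2 *\<^sub>R x"
    by (simp add: DR_def scaleR_right_distrib)
  then have "2 *\<^sub>R P B (reflection P A x) = 2 *\<^sub>R P A x"
    by (simp add: reflection_def algebra_simps scaleR_2)
  then show ?thesis
    by simp
qed

theorem proposition3p1:
  fixes A B :: "'a::real_inner set"
    and P :: "'a set \<Rightarrow> 'a \<Rightarrow> 'a"
    and x :: 'a
  assumes "finite_dim TYPE('a)"
    and "closed A" and "closed B"
    and "A \<inter> B \<noteq> {}"
    and "proj_selector P"
    and "x \<in> Fix (C_T P A B)"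
  shows "proj_set A x \<inter> A \<inter> B \<noteq> {}"
proof -
  have fixed: "C_T P A B x = x"
    using assms(6) by (simp add: Fix_def)
  have "collinear {x, reflection P A x, reflection P B (reflection P A x)}"
  proof (rule ccontr)
    assume nc: "\<not> collinear {x, reflection P A x, reflection P B (reflection P A x)}"
    with fixed circumcenter_neq_vertex[OF nc] show False
      by (simp add: C_T_def CRM_def)
  qed
  then have "P B (reflection P A x) = P A x"
    using fixed by (intro DR_fixed_imp_same_projection) (simp add: C_T_def)
  moreover have "P B (reflection P A x) \<in> proj_set B (reflection P A x)"
    and "P A x \<in> proj_set A x"
    using assms(2-5) by (auto simp: proj_selector_def)
  ultimately have "P A x \<in> proj_set A x \<inter> A \<inter> B"
    by (simp add: proj_set_def)
  then show ?thesis
    by blast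
qed

end
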